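(* For every graph $G$, $\psi_{sq}(G)\ge\beta_2(G)$.
   Context: All graphs are finite, simple and undirected. $N_G[v]$ denotes the closed neighborhood of $v$ in $G$. A sub-quorum coloring of $G$ with $k$ colors is an onto partial map $f:V(G)\dashrightarrow\{1,\ldots,k\}$ such that, with $S=\operatorname{dom}(f)$, every $v\in S$ satisfies $|\{u\in N_G[v]\cap S: f(u)=f(v)\}|\ge\frac12|N_G[v]\cap S|$; $\psi_{sq}(G)$ is the maximum such $k$. A set $S\subseteq V(G)$ is $2$-independent if the induced subgraph $G[S]$ has maximum degree at most $1$; $\beta_2(G)$ is the maximum cardinality of a $2$-independent set. *)

theory Defs
  imports "Graph_Theory.Digraph_Component"
begin

text \<open>
  A finite simple undirected graph is a member of the locale \<^locale>\<open>graph\<close>: a finite symmetric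
  digraph without loops or parallel arcs. Each undirected edge is a pair of opposite arcs, so
  \<^const>\<open>out_degree\<close> is the usual degree.
\<close>

definition closed_nbhd :: "('a, 'b) pre_digraph \<Rightarrow> 'a \<Rightarrow> 'a set" where
  "closed_nbhd G v = insert v {u \<in> verts G. v \<rightarrow>\<^bsub>G\<^esub> u}"

definition sub_quorum_coloring ::
    "('a, 'b) pre_digraph \<Rightarrow> nat \<Rightarrow> ('a \<rightharpoonup> nat) \<Rightarrow> bool" where
  "sub_quorum_coloring G k f \<longleftrightarrow>
     dom f \<subseteq> verts G \<and> ran f = {1..k} \<and>
     (\<forall>v \<in> dom f.
        real (card {u \<in> closed_nbhd G v \<inter> dom f. f u = f v})
          \<ge> 1 / 2 * real (card (closed_nbhd G v \<inter> dom f)))"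

definition psi_sq :: "('a, 'b) pre_digraph \<Rightarrow> nat" where
  "psi_sq G = Max {k. \<exists>f. sub_quorum_coloring G k f}"

definition two_independent :: "('a, 'b) pre_digraph \<Rightarrow> 'a set \<Rightarrow> bool" where
  "two_independent G S \<longleftrightarrow>
     S \<subseteq> verts G \<and> (\<forall>v \<in> verts (G \<restriction> S). out_degree (G \<restriction> S) v \<le> 1)"

definition beta_2 :: "('a, 'b) pre_digraph \<Rightarrow> nat" where
  "beta_2 G = Max {card S | S. two_independent G S}"

text \<open>Both maxima range over finite nonempty sets, also for the graph without vertices.\<close>

lemma sub_quorum_coloring_empty: "sub_quorum_coloring G 0 Map.empty"
  by (simp add: sub_quorum_coloring_def)

lemma sub_quorum_coloring_le_card:
  assumes "finite (verts G)" and "sub_quorum_coloring G k f"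
  shows "k \<le> card (verts G)"
proof -
  have d: "dom f \<subseteq> verts G" and r: "ran f = {1..k}"
    using assms(2) by (auto simp: sub_quorum_coloring_def)
  have "ran f = (the \<circ> f) ` dom f"
    by (force simp: ran_def dom_def image_iff)
  moreover have "finite (dom f)" using d assms(1) by (rule finite_subset)
  ultimately have "card (ran f) \<le> card (dom f)" by (simp add: card_image_le)
  also have "\<dots> \<le> card (verts G)" using assms(1) d by (rule card_mono)
  finally show ?thesis using r by simp
qed

lemma finite_sub_quorum_coloring_sizes:
  assumes "finite (verts G)"
  shows "finite {k. \<exists>f. sub_quorum_coloring G k f}"
  by (rule finite_subset[of _ "{..card (verts G)}"])
    (auto dest: sub_quorum_coloring_le_card[OF assms])

lemma two_independent_empty: "two_independent G {}"
  by (simp add: two_independent_def)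

lemma finite_two_independent_sizes:
  assumes "finite (verts G)"
  shows "finite {card S | S. two_independent G S}"
  by (rule finite_subset[of _ "card ` Pow (verts G)"])
    (use assms in \<open>auto simp: two_independent_def\<close>)

end

theory Submission
  imports Defs
begin

text \<open>
  Giving all vertices of a \<open>2\<close>-independent set different colors, and leaving every other vertex
  uncolored, is a sub-quorum coloring: a colored vertex has at most one colored neighbor, so it
  is itself at least half of its colored closed neighborhood. A maximum \<open>2\<close>-independent set
  therefore yields a sub-quorum coloring with \<open>beta_2 G\<close> colors.
\<close>

text \<open>Every neighbor inside \<open>S\<close> is the head of an arc of the induced subgraph, so the degree bound
  on the arcs of that subgraph bounds the number of neighbors.\<close>

lemma (in fin_digraph) card_closed_nbhd_Int_le:
  assumes "v \<in> S"
  shows "card (closed_nbhd G v \<inter> S) \<le> Suc (out_degree (G \<restriction> S) v)"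
proof -
  have "finite (out_arcs (G \<restriction> S) v)"
    by (rule finite_subset[OF _ finite_arcs]) (auto simp: out_arcs_def induce_subgraph_def)
  moreover have "closed_nbhd G v \<inter> S \<subseteq> insert v (head G ` out_arcs (G \<restriction> S) v)"
    using assms by (auto simp: closed_nbhd_def out_arcs_def induce_subgraph_def arcs_ends_conv)
  ultimately have "card (closed_nbhd G v \<inter> S) \<le> card (insert v (head G ` out_arcs (G \<restriction> S) v))"
    by (intro card_mono) auto
  also have "\<dots> \<le> Suc (card (head G ` out_arcs (G \<restriction> S) v))"
    by (simp add: card_insert_if \<open>finite (out_arcs (G \<restriction> S) v)\<close>)
  also have "\<dots> \<le> Suc (out_degree (G \<restriction> S) v)"
    using \<open>finite (out_arcs (G \<restriction> S) v)\<close> by (simp add: out_degree_def card_image_le)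
  finally show ?thesis .
qed

lemma (in fin_digraph) two_independent_imp_sub_quorum_coloring:
  assumes "two_independent G S"
  shows "\<exists>f. sub_quorum_coloring G (card S) f"
proof -
  have deg: "out_degree (G \<restriction> S) v \<le> 1" if "v \<in> S" for v
    using assms that by (simp add: two_independent_def)
  have sub: "S \<subseteq> verts G" using assms by (simp add: two_independent_def)
  then have "finite S" using finite_verts by (rule finite_subset)
  then obtain c where c: "bij_betw c S {1..card S}"
    using finite_same_card_bij[of S "{1..card S}"] by auto
  define f where "f = (Some \<circ> c) |` S"
  have dom: "dom f = S" by (auto simp: f_def restrict_map_def split: if_splits)
  have "ran f = c ` S" by (auto simp: f_def ran_def restrict_map_def)
  then have ran: "ran f = {1..card S}" using c by (simp add: bij_betw_def)
  have half: "real (card {u \<in> closed_nbhd G v \<inter> dom f. f u = f v})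
      \<ge> 1 / 2 * real (card (closed_nbhd G v \<inter> dom f))" if v: "v \<in> dom f" for v
  proof -
    have "{u \<in> closed_nbhd G v \<inter> dom f. f u = f v} = {v}"
      using v c unfolding dom
      by (auto simp: f_def bij_betw_def closed_nbhd_def dest: inj_onD)
    moreover have "card (closed_nbhd G v \<inter> S) \<le> 2"
      using card_closed_nbhd_Int_le[of v S] deg[of v] v dom by simp
    ultimately show ?thesis using dom by simp
  qed
  show ?thesis
    unfolding sub_quorum_coloring_def using dom ran half sub by blast
qed

theorem theorem3p1:
  fixes G :: "('a, 'b) pre_digraph"
  assumes "graph G"
  shows "psi_sq G \<ge> beta_2 G"
proof -
  interpret graph G by (rule assms)
  have "beta_2 G \<in> {card S | S. two_independent G S}"
    unfolding beta_2_def
    using finite_two_independent_sizes[OF finite_verts] two_independent_empty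
    by (intro Max_in) auto
  then have "beta_2 G \<in> {k. \<exists>f. sub_quorum_coloring G k f}"
    using two_independent_imp_sub_quorum_coloring by auto
  then show ?thesis
    unfolding psi_sq_def
    by (rule Max_ge[OF finite_sub_quorum_coloring_sizes[OF finite_verts]])
qed

end
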